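(* Let $\mathcal{F}_d$ be a class of real-valued functions defined on $\mathcal{X} \subset \mathbb{R}^d$. Consider the augmented input space $\mathcal{X}' = \mathcal{X} \times \mathbb{R}^m$, and define $$\mathcal{F}_{d+m} = \{ f : \mathcal{X}' \to \mathbb{R},\ f(x,x') = g(x) + h(x') \mid g \in \mathcal{F}_d,\ h \in \mathcal{H} \},$$ where $\mathcal{H}$ is a class of real-valued functions of the additional $m$ features (functions on $\mathbb{R}^m$) that contains the zero function, $0 \in \mathcal{H}$. Let $(x_1,x_1'),\dots,(x_n,x_n') \in \mathcal{X}'$ be samples, and let $\hat{\mathfrak{R}}_n(\mathcal{F}_d)$, $\hat{\mathfrak{R}}_n(\mathcal{H})$ and $\hat{\mathfrak{R}}_n(\mathcal{F}_{d+m})$ denote the empirical Rademacher complexities over the samples $\{x_i\}_{i=1}^n$, $\{x_i'\}_{i=1}^n$ and $\{(x_i,x_i')\}_{i=1}^n$ respectively. Then the following hold: 1. (Monotonicity) $\hat{\mathfrak{R}}_n(\mathcal{F}_d) \le \hat{\mathfrak{R}}_n(\mathcal{F}_{d+m})$. 2. (Additive upper bound) $\hat{\mathfrak{R}}_n(\mathcal{F}_{d+m}) \le \hat{\mathfrak{R}}_n(\mathcal{F}_d) + \hat{\mathfrak{R}}_n(\mathcal{H})$.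
   Context: For a class $\mathcal{G}$ of real-valued functions on a set $Z$ and samples $z_1,\dots,z_n \in Z$, the empirical Rademacher complexity is $$\hat{\mathfrak{R}}_n(\mathcal{G}) = \mathbb{E}_\sigma\left[ \sup_{g \in \mathcal{G}} \frac{1}{n} \sum_{i=1}^n \sigma_i\, g(z_i) \right],$$ where $\sigma_1,\dots,\sigma_n$ are independent Rademacher random variables (uniform on $\{-1,+1\}$). *)

theory Defs
  imports "HOL-Probability.Probability"
begin

definition rademacher_pmf :: "real pmf" where
  "rademacher_pmf = pmf_of_set {-1, 1}"

text \<open>The joint law of \<open>\<sigma>\<^sub>1, \<dots>, \<sigma>\<^sub>n\<close>. The product is formed by independent sampling;
  the default value 0 is only taken at indices outside \<open>{1..n}\<close>.\<close>

definition rademacher_vector_pmf :: "nat \<Rightarrow> (nat \<Rightarrow> real) pmf" where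
  "rademacher_vector_pmf n = Pi_pmf {1..n} 0 (\<lambda>_. rademacher_pmf)"

text \<open>The supremum inside an empirical Rademacher complexity may be infinite, so expectations are
  taken of extended real random variables: \<open>\<integral> X\<^sup>+ - \<integral> X\<^sup>-\<close>, where \<^const>\<open>e2ennreal\<close> truncates
  negative values to 0.\<close>

definition ereal_expectation :: "'a measure \<Rightarrow> ('a \<Rightarrow> ereal) \<Rightarrow> ereal" where
  "ereal_expectation M X =
     enn2ereal (\<integral>\<^sup>+ \<omega>. e2ennreal (X \<omega>) \<partial>M) - enn2ereal (\<integral>\<^sup>+ \<omega>. e2ennreal (- X \<omega>) \<partial>M)"

definition emp_rademacher :: "nat \<Rightarrow> (nat \<Rightarrow> 'z) \<Rightarrow> ('z \<Rightarrow> real) set \<Rightarrow> ereal" where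
  "emp_rademacher n z G =
     ereal_expectation (measure_pmf (rademacher_vector_pmf n))
       (\<lambda>\<sigma>. SUP g\<in>G. ereal (1 / real n * (\<Sum>i=1..n. \<sigma> i * g (z i))))"

text \<open>Functions with domain \<open>D\<close> are represented as elements of \<open>D \<rightarrow>\<^sub>E UNIV\<close>.\<close>

definition augmented_class ::
  "'a set \<Rightarrow> ('a \<Rightarrow> real) set \<Rightarrow> ('b \<Rightarrow> real) set \<Rightarrow> ('a \<times> 'b \<Rightarrow> real) set" where
  "augmented_class X F H =
     {f \<in> X \<times> UNIV \<rightarrow>\<^sub>E UNIV. \<exists>g\<in>F. \<exists>h\<in>H. \<forall>x\<in>X. \<forall>x'. f (x, x') = g x + h x'}"

text \<open>For integrable real random variables the extended expectation is the usual one; hence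
  \<^const>\<open>emp_rademacher\<close> is the ordinary real-valued quantity whenever the suprema are finite.\<close>

lemma ereal_expectation_eq_integral:
  fixes X :: "'a \<Rightarrow> real"
  assumes "integrable M X"
  shows "ereal_expectation M (\<lambda>\<omega>. ereal (X \<omega>)) = ereal (integral\<^sup>L M X)"
proof -
  have "(\<integral>\<^sup>+ \<omega>. ennreal (X \<omega>) \<partial>M) \<noteq> \<infinity>" "(\<integral>\<^sup>+ \<omega>. ennreal (- X \<omega>) \<partial>M) \<noteq> \<infinity>"
    using assms by (auto simp: real_integrable_def)
  then show ?thesis
    unfolding ereal_expectation_def real_lebesgue_integral_def[OF assms]
    by (cases "\<integral>\<^sup>+ \<omega>. ennreal (X \<omega>) \<partial>M" rule: ennreal_cases;
        cases "\<integral>\<^sup>+ \<omega>. ennreal (- X \<omega>) \<partial>M" rule: ennreal_cases)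
       (simp_all add: ennreal_def[symmetric] e2ennreal_ereal)
qed

lemma finite_set_rademacher_vector_pmf: "finite (set_pmf (rademacher_vector_pmf n))"
proof -
  have "set_pmf (rademacher_vector_pmf n) \<subseteq> PiE_dflt {1..n} 0 (\<lambda>_. {-1, 1 :: real})"
    unfolding rademacher_vector_pmf_def
    by (subst set_Pi_pmf) (auto simp: rademacher_pmf_def PiE_dflt_def)
  moreover have "finite (PiE_dflt {1..n} 0 (\<lambda>_. {-1, 1 :: real}))"
    by (intro finite_PiE_dflt) auto
  ultimately show ?thesis
    by (rule finite_subset)
qed

lemma emp_rademacher_eq_expectation:
  assumes "G \<noteq> {}"
    and "\<And>\<sigma>. bdd_above ((\<lambda>g. 1 / real n * (\<Sum>i=1..n. \<sigma> i * g (z i))) ` G)"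
  shows "emp_rademacher n z G =
    ereal (measure_pmf.expectation (rademacher_vector_pmf n)
      (\<lambda>\<sigma>. SUP g\<in>G. 1 / real n * (\<Sum>i=1..n. \<sigma> i * g (z i))))"
proof -
  have "(SUP g\<in>G. ereal (1 / real n * (\<Sum>i=1..n. \<sigma> i * g (z i)))) =
      ereal (SUP g\<in>G. 1 / real n * (\<Sum>i=1..n. \<sigma> i * g (z i)))" for \<sigma>
  proof (rule ereal_SUP[symmetric])
    let ?f = "\<lambda>g. 1 / real n * (\<Sum>i=1..n. \<sigma> i * g (z i))"
    obtain g where g: "g \<in> G"
      using assms(1) by blast
    obtain B where B: "\<And>g. g \<in> G \<Longrightarrow> ?f g \<le> B"
      using assms(2)[of \<sigma>] by (auto simp: bdd_above_def)
    have "ereal (?f g) \<le> (SUP g\<in>G. ereal (?f g))"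
      using g by (rule SUP_upper)
    moreover have "(SUP g\<in>G. ereal (?f g)) \<le> ereal B"
      using B by (intro SUP_least) (simp only: ereal_less_eq)
    ultimately show "\<bar>SUP g\<in>G. ereal (?f g)\<bar> \<noteq> \<infinity>"
      by (cases "SUP g\<in>G. ereal (?f g)") auto
  qed
  then show ?thesis
    unfolding emp_rademacher_def
    by (simp only: ereal_expectation_eq_integral integrable_measure_pmf_finite
        finite_set_rademacher_vector_pmf)
qed

end

theory Submission
  imports Defs
begin

text \<open>Pointwise in \<open>\<sigma>\<close>, the supremum over \<open>F\<close> is at most that over the augmented class (take \<open>h = 0\<close>),
  which is at most the sum of the suprema over \<open>F\<close> and \<open>H\<close>. It remains to see that the extended
  expectation is monotone, and additive when both negative parts are integrable; the latter holds
  because \<open>\<sigma>\<close> takes finitely many values and a supremum over a nonempty class is never \<open>-\<infinity>\<close>.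
  If \<open>F\<close> is empty, both \<open>F\<close> and the augmented class have complexity \<open>-\<infinity>\<close>.\<close>

lemma ereal_expectation_mono:
  assumes "\<And>\<omega>. X \<omega> \<le> Y \<omega>"
  shows "ereal_expectation M X \<le> ereal_expectation M Y"
  unfolding ereal_expectation_def
  using assms
  by (intro ereal_minus_mono)
     (auto simp flip: less_eq_ennreal.rep_eq intro!: nn_integral_mono e2ennreal_mono)

text \<open>This is \<open>(a + b)\<^sup>+ - (a + b)\<^sup>- = a\<^sup>+ - a\<^sup>- + b\<^sup>+ - b\<^sup>-\<close> rearranged so that no
  subtraction occurs; it then also holds for infinite values.\<close>

lemma e2ennreal_parts_add:
  "e2ennreal (a + b) + (e2ennreal (- a) + e2ennreal (- b)) =
   e2ennreal a + e2ennreal b + e2ennreal (- (a + b))"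
proof (cases a; cases b)
  fix r s assume [simp]: "a = ereal r" "b = ereal s"
  have "ennreal (r + s) + (ennreal (- r) + ennreal (- s)) =
      ennreal (max 0 (r + s) + (max 0 (- r) + max 0 (- s)))"
    by (simp add: ennreal_plus max_def ennreal_neg)
  also have "max 0 (r + s) + (max 0 (- r) + max 0 (- s)) =
      max 0 r + max 0 s + max 0 (- (r + s))"
    by (simp add: max_def)
  also have "ennreal \<dots> = ennreal r + ennreal s + ennreal (- (r + s))"
    by (simp add: ennreal_plus max_def ennreal_neg)
  finally show ?thesis
    by simp
\<comment> \<open>If \<open>a\<close> or \<open>b\<close> is infinite, both sides are
  \<open>top\<close>; this includes opposite infinities, whose sum is \<infinity> in
  \<open>ereal\<close>.\<close>
qed simp_all

text \<open>The right-hand side is nonnegative and dominates \<open>a + b\<close>, so truncating it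
  at 0 changes nothing.\<close>

lemma e2ennreal_add_le: "e2ennreal (a + b) \<le> e2ennreal a + e2ennreal b"
proof -
  have le: "c \<le> enn2ereal (e2ennreal c)" for c
    by (cases "0 \<le> c") (auto simp: enn2ereal_e2ennreal intro: order_trans[OF _ enn2ereal_nonneg])
  have "a + b \<le> enn2ereal (e2ennreal a + e2ennreal b)"
    unfolding plus_ennreal.rep_eq by (intro add_mono le)
  then show ?thesis
    by (metis e2ennreal_mono e2ennreal_enn2ereal)
qed

text \<open>Equality fails for opposite infinities: their sum is \<infinity> in either order, so the
  left side is -\<infinity> and the right side \<infinity>.\<close>

lemma ereal_uminus_add_le: "- (a + b) \<le> - a + - (b :: ereal)"
  by (cases a; cases b) auto

lemma ereal_expectation_add:
  assumes [measurable]: "X \<in> borel_measurable M" "Y \<in> borel_measurable M"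
    and X: "(\<integral>\<^sup>+ \<omega>. e2ennreal (- X \<omega>) \<partial>M) \<noteq> \<infinity>"
    and Y: "(\<integral>\<^sup>+ \<omega>. e2ennreal (- Y \<omega>) \<partial>M) \<noteq> \<infinity>"
  shows "ereal_expectation M (\<lambda>\<omega>. X \<omega> + Y \<omega>) = ereal_expectation M X + ereal_expectation M Y"
proof -
  let ?P = "\<lambda>Z. \<integral>\<^sup>+ \<omega>. e2ennreal (Z \<omega>) \<partial>M" and ?N = "\<lambda>Z. \<integral>\<^sup>+ \<omega>. e2ennreal (- Z \<omega>) \<partial>M"
  let ?Z = "\<lambda>\<omega>. X \<omega> + Y \<omega>"
  have parts: "?P ?Z + (?N X + ?N Y) = ?P X + ?P Y + ?N ?Z"
    by (simp add: e2ennreal_parts_add flip: nn_integral_add)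
  \<comment> \<open>Cancelling in \<open>parts\<close> also requires the negative part of the sum to
    have a finite integral.\<close>
  have "?N ?Z \<le> (\<integral>\<^sup>+ \<omega>. e2ennreal (- X \<omega>) + e2ennreal (- Y \<omega>) \<partial>M)"
    by (intro nn_integral_mono order_trans[OF e2ennreal_mono[OF ereal_uminus_add_le]]
        e2ennreal_add_le)
  also have "\<dots> = ?N X + ?N Y"
    by (simp add: nn_integral_add)
  also have "\<dots> < \<infinity>"
    using X Y by (simp add: less_top)
  finally have Z: "?N ?Z \<noteq> \<infinity>"
    by simp
  \<comment> \<open>Only the subtracted quantities must be finite for the rearrangement;
    \<open>p\<close>, \<open>p1\<close> and \<open>p2\<close> may be \<open>top\<close>, in which
    case both sides are \<infinity>.\<close>
  have diff: "enn2ereal p - enn2ereal q = enn2ereal p1 - enn2ereal q1 + (enn2ereal p2 - enn2ereal q2)"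
    if eq: "p + (q1 + q2) = p1 + p2 + q" and fin: "q \<noteq> \<infinity>" "q1 \<noteq> \<infinity>" "q2 \<noteq> \<infinity>" for p q p1 q1 p2 q2
  proof -
    obtain r r1 r2 where [simp]: "q = ennreal r" "q1 = ennreal r1" "q2 = ennreal r2"
      and [simp]: "0 \<le> r" "0 \<le> r1" "0 \<le> r2"
      using fin
      by (cases q rule: ennreal_cases; cases q1 rule: ennreal_cases; cases q2 rule: ennreal_cases)
         auto
    show ?thesis
    proof (cases "p1 = top \<or> p2 = top")
      case True
      then have "p = top"
        using eq by (auto simp flip: ennreal_plus)
      then show ?thesis
        using True by (cases p1 rule: ennreal_cases; cases p2 rule: ennreal_cases) auto
    next
      case False
      then obtain s1 s2 where [simp]: "p1 = ennreal s1" "p2 = ennreal s2" "0 \<le> s1" "0 \<le> s2"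
        by (cases p1 rule: ennreal_cases; cases p2 rule: ennreal_cases) auto
      then obtain s where [simp]: "p = ennreal s" "0 \<le> s"
        using eq by (cases p rule: ennreal_cases) (auto simp flip: ennreal_plus)
      have "s + (r1 + r2) = s1 + s2 + r"
        using eq by (simp flip: ennreal_plus)
      then show ?thesis
        by simp
    qed
  qed
  show ?thesis
    unfolding ereal_expectation_def using parts Z X Y by (rule diff)
qed

lemma nn_integral_measure_pmf_finite_ne_top:
  assumes "finite (set_pmf p)" "\<And>\<omega>. f \<omega> \<noteq> \<infinity>"
  shows "(\<integral>\<^sup>+ \<omega>. f \<omega> \<partial>measure_pmf p) \<noteq> \<infinity>"
  using assms
  by (simp add: nn_integral_measure_pmf_finite ennreal_mult_eq_top_iff)

text \<open>The positive part integrates to 0, and the negative part to \<open>top\<close> because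
  the total mass is 1.\<close>

lemma ereal_expectation_bot:
  "ereal_expectation (measure_pmf p) (\<lambda>_. - \<infinity>) = - \<infinity>"
  by (simp add: ereal_expectation_def e2ennreal_neg zero_ennreal.rep_eq)

lemma emp_rademacher_empty: "emp_rademacher n z {} = - \<infinity>"
  by (simp add: emp_rademacher_def bot_ereal_def ereal_expectation_bot)

text \<open>Any single member of \<open>G\<close> bounds the supremum below by a real number for
  each \<sigma>, and the law of \<sigma> has finite support.\<close>

lemma emp_rademacher_negative_part_finite:
  assumes "G \<noteq> {}"
  shows "(\<integral>\<^sup>+ \<sigma>. e2ennreal (- (SUP g\<in>G. ereal (1 / real n * (\<Sum>i=1..n. \<sigma> i * g (z i)))))
    \<partial>measure_pmf (rademacher_vector_pmf n)) \<noteq> \<infinity>"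
proof (rule nn_integral_measure_pmf_finite_ne_top[OF finite_set_rademacher_vector_pmf])
  fix \<sigma> :: "nat \<Rightarrow> real"
  let ?f = "\<lambda>g. 1 / real n * (\<Sum>i=1..n. \<sigma> i * g (z i))"
  obtain g where "g \<in> G"
    using assms by blast
  then have "ereal (?f g) \<le> (SUP g\<in>G. ereal (?f g))"
    by (rule SUP_upper)
  then have "e2ennreal (- (SUP g\<in>G. ereal (?f g))) \<le> e2ennreal (- ereal (?f g))"
    by (intro e2ennreal_mono) (simp only: ereal_minus_le_minus)
  also have "\<dots> < \<infinity>"
    by simp
  finally show "e2ennreal (- (SUP g\<in>G. ereal (?f g))) \<noteq> \<infinity>"
    by simp
qed

lemma emp_rademacher_le_augmented_class:
  assumes "(\<lambda>_. 0) \<in> H" "\<And>i. i \<in> {1..n} \<Longrightarrow> x i \<in> X"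
  shows "emp_rademacher n x F \<le> emp_rademacher n (\<lambda>i. (x i, x' i)) (augmented_class X F H)"
  unfolding emp_rademacher_def
proof (intro ereal_expectation_mono SUP_least)
  fix \<sigma> :: "nat \<Rightarrow> real" and g assume "g \<in> F"
  \<comment> \<open>This is \<open>g + 0\<close>, restricted because members of the augmented class
    are extensional; the samples lie in \<open>X\<close>, so their values are unaffected.\<close>
  let ?f = "restrict (\<lambda>(u, _). g u) (X \<times> UNIV)"
  have "?f \<in> augmented_class X F H"
    unfolding augmented_class_def
    by (auto intro!: bexI[OF _ \<open>g \<in> F\<close>] bexI[OF _ assms(1)])
  moreover have "(\<Sum>i=1..n. \<sigma> i * g (x i)) = (\<Sum>i=1..n. \<sigma> i * ?f (x i, x' i))"
    using assms(2) by (intro sum.cong) auto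
  ultimately show "ereal (1 / real n * (\<Sum>i=1..n. \<sigma> i * g (x i)))
      \<le> (SUP f\<in>augmented_class X F H. ereal (1 / real n * (\<Sum>i=1..n. \<sigma> i * f (x i, x' i))))"
    by (intro SUP_upper2[of ?f]) (simp_all only: order_refl)
qed

lemma emp_rademacher_augmented_class_le:
  assumes "H \<noteq> {}" "\<And>i. i \<in> {1..n} \<Longrightarrow> x i \<in> X"
  shows "emp_rademacher n (\<lambda>i. (x i, x' i)) (augmented_class X F H)
    \<le> emp_rademacher n x F + emp_rademacher n x' H"
proof (cases "F = {}")
  \<comment> \<open>Here the left-hand side is -\<infinity>; the additivity argument below needs
    both classes nonempty to control the negative parts.\<close>
  case True
  then show ?thesis
    by (simp add: augmented_class_def emp_rademacher_empty)
next
  case False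
  let ?S = "\<lambda>z G \<sigma>. SUP g\<in>G. ereal (1 / real n * (\<Sum>i=1..n. \<sigma> i * g (z i)))"
  let ?E = "ereal_expectation (measure_pmf (rademacher_vector_pmf n))"
  have "?E (\<lambda>\<sigma>. SUP f\<in>augmented_class X F H.
      ereal (1 / real n * (\<Sum>i=1..n. \<sigma> i * f (x i, x' i)))) \<le> ?E (\<lambda>\<sigma>. ?S x F \<sigma> + ?S x' H \<sigma>)"
  proof (intro ereal_expectation_mono SUP_least)
    fix \<sigma> :: "nat \<Rightarrow> real" and f assume "f \<in> augmented_class X F H"
    then obtain g h where gh: "g \<in> F" "h \<in> H" "\<And>u v. u \<in> X \<Longrightarrow> f (u, v) = g u + h v"
      by (auto simp: augmented_class_def)
    have "(\<Sum>i=1..n. \<sigma> i * f (x i, x' i)) =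
        (\<Sum>i=1..n. \<sigma> i * g (x i)) + (\<Sum>i=1..n. \<sigma> i * h (x' i))"
      unfolding sum.distrib[symmetric] using gh(3) assms(2)
      by (intro sum.cong) (auto simp: distrib_left)
    then have "ereal (1 / real n * (\<Sum>i=1..n. \<sigma> i * f (x i, x' i))) =
        ereal (1 / real n * (\<Sum>i=1..n. \<sigma> i * g (x i))) +
        ereal (1 / real n * (\<Sum>i=1..n. \<sigma> i * h (x' i)))"
      by (simp only: distrib_left plus_ereal.simps)
    \<comment> \<open>The two summands are maximised separately, for the same \<sigma>.\<close>
    also have "\<dots> \<le> ?S x F \<sigma> + ?S x' H \<sigma>"
      using gh by (intro add_mono SUP_upper)
    finally show "ereal (1 / real n * (\<Sum>i=1..n. \<sigma> i * f (x i, x' i))) \<le> ?S x F \<sigma> + ?S x' H \<sigma>" .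
  qed
  also have "\<dots> = ?E (?S x F) + ?E (?S x' H)"
    using False assms(1) by (intro ereal_expectation_add emp_rademacher_negative_part_finite) auto
  finally show ?thesis
    unfolding emp_rademacher_def .
qed

theorem theorem3:
  fixes X :: "(real ^ 'd) set"
    and F :: "(real ^ 'd \<Rightarrow> real) set"
    and H :: "(real ^ 'm \<Rightarrow> real) set"
    and n :: nat
    and x :: "nat \<Rightarrow> real ^ 'd"
    and x' :: "nat \<Rightarrow> real ^ 'm"
  assumes "F \<subseteq> X \<rightarrow>\<^sub>E UNIV"
    and "(\<lambda>_. 0) \<in> H"
    and "n \<ge> 1"
    and "\<And>i. i \<in> {1..n} \<Longrightarrow> x i \<in> X"
  shows "emp_rademacher n x F
           \<le> emp_rademacher n (\<lambda>i. (x i, x' i)) (augmented_class X F H)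
         \<and> emp_rademacher n (\<lambda>i. (x i, x' i)) (augmented_class X F H)
           \<le> emp_rademacher n x F + emp_rademacher n x' H"
  using assms(2,4)
  by (auto intro!: emp_rademacher_le_augmented_class emp_rademacher_augmented_class_le)

end
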